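(* Let $r>0$ be real and let $N\ge 1$ be an integer. Let $$\Gamma_L(z) = (z+r)^{z-\frac12}e^{-(z+r)}\left[b_0(r)+\sum_{n=1}^{N} b_n(r)H_n(z)\right]$$ be the Lanczos approximation of the gamma function, where $$H_n(z)=\frac{\Gamma^2(z)}{\Gamma(z+n)\Gamma(z-n)}=\frac{(z-1)(z-2)\cdots(z-n)}{z(z+1)\cdots(z+n-1)},$$ $$b_0(r)=\frac{e^{r+1}}{\sqrt{r+1}}=F_r(1),\qquad b_n(r)=2n\sum_{k=0}^{n}(-1)^{n-k}\frac{(n+k-1)!}{(k!)^2\,(n-k)!}\,F_r(k+1)\quad (n\ge 1).$$ Then $\Gamma_L$ is exact at $z=1,2,\ldots,N+1$, i.e. $\Gamma_L(m)=\Gamma(m)$ for every $m\in\{1,2,\ldots,N+1\}$.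
   Context: $\Gamma$ is the Euler gamma function. For a real parameter $r>0$, the scaled gamma function is $$F_r(z)=\frac{\Gamma(z)\,e^{z+r}}{(z+r)^{z-\frac12}},$$ where powers of $z+r$ are taken with the principal branch (positive real for $z+r>0$). *)

theory Defs
  imports "HOL-Analysis.Analysis"
begin

definition scaled_Gamma :: "real \<Rightarrow> complex \<Rightarrow> complex" where
  "scaled_Gamma r z =
     Gamma z * exp (z + of_real r) / (z + of_real r) powr (z - 1/2)"

(* The quotient of Gamma functions defining H_n is understood with its removable
   singularities filled in, so the rational form is the definition; the lemma
   lanczos_H_eq_Gamma recovers the quotient, with the entire function
   rGamma = 1/Gamma in place of the denominators. *)
definition lanczos_H :: "nat \<Rightarrow> complex \<Rightarrow> complex" where
  "lanczos_H n z = (\<Prod>j=1..n. z - of_nat j) / (\<Prod>j<n. z + of_nat j)"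

definition lanczos_b :: "real \<Rightarrow> nat \<Rightarrow> complex" where
  "lanczos_b r n =
     (if n = 0 then of_real (exp (r + 1) / sqrt (r + 1))
      else 2 * of_nat n *
        (\<Sum>k=0..n. (-1) ^ (n - k) * (fact (n + k - 1) / ((fact k)\<^sup>2 * fact (n - k))) *
           scaled_Gamma r (of_nat (k + 1))))"

definition lanczos_Gamma :: "real \<Rightarrow> nat \<Rightarrow> complex \<Rightarrow> complex" where
  "lanczos_Gamma r N z =
     (z + of_real r) powr (z - 1/2) * exp (- (z + of_real r)) *
     (lanczos_b r 0 + (\<Sum>n=1..N. lanczos_b r n * lanczos_H n z))"

lemma lanczos_b_0:
  assumes "r > 0"
  shows "lanczos_b r 0 = scaled_Gamma r 1"
proof -
  have "(of_real (1 + r) :: complex) powr of_real (1/2) = of_real ((1 + r) powr (1/2))"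
    using assms by (intro powr_of_real) auto
  then have "(1 + of_real r :: complex) powr (1/2) = of_real (sqrt (1 + r))"
    using assms by (simp add: powr_half_sqrt)
  then show ?thesis
    by (simp add: lanczos_b_def scaled_Gamma_def add.commute exp_of_real[symmetric])
qed

lemma lanczos_H_eq_Gamma:
  assumes "z \<notin> \<int>\<^sub>\<le>\<^sub>0"
  shows "lanczos_H n z = (Gamma z)\<^sup>2 * rGamma (z + of_nat n) * rGamma (z - of_nat n)"
proof -
  have g: "Gamma z * rGamma z = 1"
    using assms by (simp add: rGamma_inverse_Gamma Gamma_eq_zero_iff)
  have a: "rGamma z = pochhammer z n * rGamma (z + of_nat n)"
    by (rule pochhammer_rGamma)
  have b: "rGamma (z - of_nat n) = pochhammer (z - of_nat n) n * rGamma z"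
    using pochhammer_rGamma[of "z - of_nat n" n] by simp
  have p: "pochhammer z n = (\<Prod>j<n. z + of_nat j)"
    by (simp add: pochhammer_prod atLeast0LessThan)
  have "pochhammer (z - of_nat n) n = (\<Prod>j=0..<n. z - of_nat n + of_nat j)"
    by (simp add: pochhammer_prod)
  also have "\<dots> = (\<Prod>j=1..n. z - of_nat j)"
    by (rule prod.reindex_bij_witness[of _ "\<lambda>j. n - j" "\<lambda>j. n - j"]) (auto simp: of_nat_diff)
  finally have q: "pochhammer (z - of_nat n) n = (\<Prod>j=1..n. z - of_nat j)" .
  have nz: "pochhammer z n \<noteq> 0"
    using g a by auto
  have "(Gamma z)\<^sup>2 * rGamma (z + of_nat n) * rGamma (z - of_nat n)
      = (Gamma z * rGamma z) * (Gamma z * (pochhammer z n * rGamma (z + of_nat n)))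
        * pochhammer (z - of_nat n) n / pochhammer z n"
    using nz b by (simp add: power2_eq_square)
  also have "\<dots> = pochhammer (z - of_nat n) n / pochhammer z n"
    unfolding a[symmetric] g by simp
  finally show ?thesis
    by (simp add: lanczos_H_def p q)
qed

end

theory Submission
  imports Defs
begin

text \<open>
  Write \<open>F\<^sub>k\<close> for the scaled gamma function at \<open>k + 1\<close>. Up to the prefactor that turns \<open>F\<^sub>M\<close>
  back into \<open>\<Gamma>(M + 1)\<close>, exactness at \<open>M + 1\<close> says \<open>b\<^sub>0 + (\<Sum>n=1..N. b\<^sub>n H\<^sub>n(M + 1)) = F\<^sub>M\<close>.
  This is a purely algebraic identity, valid for any sequence of samples \<open>F\<close>: every \<open>b\<^sub>n\<close> is a
  combination of \<open>F\<^sub>0, \<dots>, F\<^sub>n\<close> with coefficients free of \<open>r\<close>.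

  The factor \<open>z - (M + 1)\<close> in the numerator makes \<open>H\<^sub>n(M + 1)\<close> vanish for \<open>n > M\<close>, so when \<open>M \<le> N\<close>
  the sum stops at \<open>M\<close>, and the matrix of the values \<open>H\<^sub>n(M + 1)\<close> is lower triangular. The
  coefficients in the \<open>b\<^sub>n\<close> form its inverse matrix (\<open>lanczos_orthogonality\<close>). For the entries
  off the diagonal this is a sum that telescopes once it is multiplied by \<open>M - k\<close>, and the
  antidifference vanishes at the upper end (\<open>lanczos_partial_sum\<close>).
\<close>

text \<open>
  At \<open>k = 0\<close> the formula for \<open>n \<ge> 1\<close> reduces to \<open>2 (-1)\<^sup>n\<close>. Row \<open>0\<close> has half of the value \<open>2\<close> that
  this would give at \<open>n = 0\<close>, like the constant term of a Chebyshev expansion; this is the value with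
  which the telescoping sum can start at \<open>n = k = 0\<close>.
\<close>
definition lanczos_coeff :: "nat \<Rightarrow> nat \<Rightarrow> complex" where
  "lanczos_coeff n k =
     (if n = 0 then 1
      else 2 * of_nat n * ((-1) ^ (n - k) * (fact (n + k - 1) / ((fact k)\<^sup>2 * fact (n - k)))))"

lemma lanczos_b_eq_sum:
  assumes "r > 0"
  shows "lanczos_b r n = (\<Sum>k\<le>n. lanczos_coeff n k * scaled_Gamma r (of_nat (k + 1)))"
proof (cases "n = 0")
  case True
  then show ?thesis
    using lanczos_b_0[OF assms] by (simp add: lanczos_coeff_def)
next
  case False
  then show ?thesis
    by (simp add: lanczos_b_def lanczos_coeff_def sum_distrib_left atLeast0AtMost mult.assoc)
qed

lemma lanczos_H_of_nat:
  assumes "n \<le> M"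
  shows "lanczos_H n (of_nat (M + 1)) = (fact M)\<^sup>2 / (fact (M - n) * fact (M + n))"
  using assms
proof (induction n)
  case 0
  then show ?case
    by (simp add: lanczos_H_def power2_eq_square)
next
  case (Suc n)
  then obtain d where d: "M = Suc (n + d)"
    using le_Suc_ex[OF Suc.prems] by auto
  have "lanczos_H (Suc n) (of_nat (M + 1))
      = lanczos_H n (of_nat (M + 1)) * ((of_nat (M + 1) - of_nat (Suc n)) / (of_nat (M + 1) + of_nat n))"
    by (simp add: lanczos_H_def)
  also have "\<dots> = (fact M)\<^sup>2 / (fact (M - n) * fact (M + n)) * (of_nat (M - n) / of_nat (Suc (M + n)))"
    using Suc by (simp add: of_nat_diff algebra_simps)
  also have "\<dots> = (fact M)\<^sup>2 / (fact (M - Suc n) * fact (M + Suc n))"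
  proof -
    have "fact (M - n) = (of_nat (M - n) * fact (M - Suc n) :: complex)"
      using d by (simp add: fact_Suc)
    moreover have "fact (M + Suc n) = (of_nat (Suc (M + n)) * fact (M + n) :: complex)"
      by (simp add: fact_Suc del: of_nat_Suc)
    moreover have "of_nat (M - n) \<noteq> (0 :: complex)"
      using d by (simp del: of_nat_Suc)
    ultimately show ?thesis
      by (simp del: of_nat_Suc add: divide_simps)
  qed
  finally show ?case .
qed

lemma lanczos_H_of_nat_eq_0:
  assumes "M < n"
  shows "lanczos_H n (of_nat (M + 1)) = 0"
proof -
  have "(\<Prod>j=1..n. of_nat (M + 1) - of_nat j) = (0 :: complex)"
    using assms by (intro prod_zero) (auto intro!: bexI[of _ "M + 1"])
  then show ?thesis
    by (simp add: lanczos_H_def)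
qed

text \<open>
  The right-hand side is the hypergeometric antidifference of the summand. The step from \<open>j\<close> to
  \<open>j + 1\<close>, cleared of factorials, is the identity \<open>(n - k)(M + n) + (M - n)(n + k) = 2n(M - k)\<close> at
  \<open>n = j + 1\<close>.
\<close>
lemma lanczos_partial_sum:
  assumes "k \<le> j" "j \<le> M"
  shows "of_nat (M - k) * (\<Sum>n=k..j. lanczos_coeff n k / (fact (M - n) * fact (M + n)))
       = (-1) ^ (j - k) * of_nat (M - j) * fact (j + k)
         / ((fact k)\<^sup>2 * fact (j - k) * fact (M - j) * fact (M + j))"
  using assms
proof (induction j rule: dec_induct)
  case base
  show ?case
  proof (cases k)
    case 0
    then show ?thesis by (simp add: lanczos_coeff_def)
  next
    case (Suc i)
    have "fact (k + k) = (2 * of_nat k * fact (k + k - 1) :: complex)"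
      using Suc by (simp add: fact_reduce[of "k + k"] algebra_simps)
    then show ?thesis
      using Suc by (simp add: lanczos_coeff_def field_simps)
  qed
next
  case (step j)
  obtain d where d: "j = k + d"
    using step.hyps le_Suc_ex by auto
  obtain e where e: "M = Suc (j + e)"
    using le_Suc_ex[OF step.prems] by auto
  \<comment> \<open>The common factor of the new summand and the two values of the antidifference: dividing
    by it leaves the integer polynomials of the identity above.\<close>
  define C :: complex where "C = (-1) ^ d * fact (j + k)
    / ((fact k)\<^sup>2 * fact (Suc d) * fact e * fact (Suc (M + j)))"
  have C_old: "(-1) ^ (j - k) * of_nat (M - j) * fact (j + k)
         / ((fact k)\<^sup>2 * fact (j - k) * fact (M - j) * fact (M + j))
       = C * (of_nat (Suc d) * of_nat (Suc (M + j)))"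
  proof -
    have "of_nat (Suc d) \<noteq> (0::complex)" "of_nat (Suc e) \<noteq> (0::complex)"
      "of_nat (Suc (M + j)) \<noteq> (0::complex)"
      by (simp_all del: of_nat_Suc)
    moreover have "j - k = d" "M - j = Suc e"
      using d e by auto
    ultimately show ?thesis
      by (simp add: C_def fact_Suc divide_simps del: of_nat_Suc)
  qed
  have C_term: "lanczos_coeff (Suc j) k / (fact (M - Suc j) * fact (M + Suc j))
       = - (C * (2 * of_nat (Suc j)))"
  proof -
    have "Suc j - k = Suc d" "M - Suc j = e" "Suc j + k - 1 = j + k"
      using d e by auto
    then show ?thesis
      by (simp add: C_def lanczos_coeff_def mult_ac del: of_nat_Suc fact_Suc)
  qed
  have C_new: "(-1) ^ (Suc j - k) * of_nat (M - Suc j) * fact (Suc j + k)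
         / ((fact k)\<^sup>2 * fact (Suc j - k) * fact (M - Suc j) * fact (M + Suc j))
       = - (C * (of_nat e * of_nat (Suc (j + k))))"
  proof -
    have "Suc j - k = Suc d" "M - Suc j = e"
      using d e by auto
    moreover have "fact (Suc j + k) = (of_nat (Suc (j + k)) * fact (j + k) :: complex)"
      by (simp add: fact_Suc del: of_nat_Suc)
    ultimately show ?thesis
      by (simp add: C_def del: of_nat_Suc fact_Suc)
  qed
  have M: "M - k = Suc (d + e)"
    using d e by simp
  have "of_nat (M - k) * (\<Sum>n=k..Suc j. lanczos_coeff n k / (fact (M - n) * fact (M + n)))
      = C * (of_nat (Suc d) * of_nat (Suc (M + j))) - of_nat (M - k) * (C * (2 * of_nat (Suc j)))"
    using step.IH[unfolded C_old] step.prems step.hyps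
    by (simp only: sum.nat_ivl_Suc' C_term distrib_left) simp
  also have "\<dots> = - (C * (of_nat e * of_nat (Suc (j + k))))"
    unfolding M by (simp add: d e algebra_simps)
  finally show ?case
    by (simp only: C_new)
qed

text \<open>
  At \<open>j = M\<close> the antidifference is \<open>0\<close>, and \<open>M - k\<close> can be cancelled when \<open>k < M\<close>. For \<open>k = M\<close> that
  argument only says \<open>0 = 0\<close>, but the sum has a single term.
\<close>
lemma lanczos_orthogonality:
  assumes "k \<le> M"
  shows "(\<Sum>n=k..M. lanczos_coeff n k * lanczos_H n (of_nat (M + 1))) = of_bool (k = M)"
proof -
  have H: "(\<Sum>n=k..M. lanczos_coeff n k * lanczos_H n (of_nat (M + 1)))
      = (fact M)\<^sup>2 * (\<Sum>n=k..M. lanczos_coeff n k / (fact (M - n) * fact (M + n)))"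
    unfolding sum_distrib_left
    by (intro sum.cong refl) (simp add: lanczos_H_of_nat[simplified])
  show ?thesis
  proof (cases "k = M")
    case True
    have "(fact M)\<^sup>2 * lanczos_coeff M M = fact (M + M)"
    proof (cases "M = 0")
      case False
      then have "fact (M + M) = (2 * of_nat M * fact (M + M - 1) :: complex)"
        by (simp add: fact_reduce[of "M + M"] algebra_simps)
      with False show ?thesis
        by (simp add: lanczos_coeff_def)
    qed (simp add: lanczos_coeff_def)
    then show ?thesis
      unfolding H using True by simp
  next
    case False
    then have "of_nat (M - k) \<noteq> (0 :: complex)"
      using assms by simp
    moreover have "of_nat (M - k) * (\<Sum>n=k..M. lanczos_coeff n k / (fact (M - n) * fact (M + n)))
        = (0 :: complex)"
      using lanczos_partial_sum[OF assms order_refl] by simp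
    ultimately show ?thesis
      unfolding H using False by simp
  qed
qed

text \<open>
  Interchanging the sum over \<open>n\<close> with the sum inside \<open>b\<^sub>n\<close> gives each sample \<open>F\<^sub>k\<close> an orthogonality
  sum as its coefficient, so only \<open>F\<^sub>M\<close> survives.
\<close>
lemma lanczos_series_of_nat:
  assumes "r > 0" "M \<le> N"
  shows "lanczos_b r 0 + (\<Sum>n=1..N. lanczos_b r n * lanczos_H n (of_nat (M + 1)))
       = scaled_Gamma r (of_nat (M + 1))"
proof -
  define F where "F k = scaled_Gamma r (of_nat (k + 1))" for k
  define h where "h n = lanczos_H n (of_nat (M + 1))" for n
  have "lanczos_b r 0 + (\<Sum>n=1..N. lanczos_b r n * h n) = (\<Sum>n\<le>N. lanczos_b r n * h n)"
    by (simp add: sum.atMost_shift sum.atLeast1_atMost_eq lessThan_Suc_atMost h_def lanczos_H_def)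
  also have "\<dots> = (\<Sum>n\<le>M. lanczos_b r n * h n)"
    using assms(2) by (intro sum.mono_neutral_right) (auto simp: h_def lanczos_H_of_nat_eq_0[simplified])
  also have "\<dots> = (\<Sum>n\<le>M. \<Sum>k\<le>n. F k * (lanczos_coeff n k * h n))"
    by (simp add: lanczos_b_eq_sum[OF assms(1)] F_def sum_distrib_left sum_distrib_right mult_ac)
  also have "\<dots> = (\<Sum>k\<le>M. \<Sum>n=k..M. F k * (lanczos_coeff n k * h n))"
  proof -
    have "{..n} = {k \<in> {..M}. k \<le> n}" if "n \<le> M" for n
      using that by auto
    moreover have "{k..M} = {n \<in> {..M}. k \<le> n}" for k
      by auto
    ultimately show ?thesis
      using sum.swap_restrict[of "{..M}" "{..M}" "\<lambda>n k. F k * (lanczos_coeff n k * h n)" "\<lambda>n k. k \<le> n"]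
      by simp
  qed
  also have "\<dots> = (\<Sum>k\<le>M. F k * of_bool (k = M))"
    by (intro sum.cong refl) (simp only: sum_distrib_left[symmetric] h_def lanczos_orthogonality atMost_iff)
  also have "\<dots> = F M"
    by (simp add: of_bool_def if_distrib cong: if_cong)
  finally show ?thesis
    by (simp only: F_def h_def)
qed

theorem theorem1:
  fixes r :: real and N m :: nat
  assumes "r > 0" and "N \<ge> 1" and "m \<in> {1..N + 1}"
  shows "lanczos_Gamma r N (of_nat m) = Gamma (of_nat m)"
proof -
  obtain M where m: "m = M + 1" and "M \<le> N"
    using assms(3) by (intro that[of "m - 1"]) auto
  define w :: complex where "w = of_nat m + of_real r"
  have "w = of_real (of_nat m + r)"
    by (simp add: w_def)
  then have "w \<noteq> 0"
    using assms(1) by (metis add_nonneg_pos less_irrefl of_nat_0_le_iff of_real_eq_0_iff)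
  have "lanczos_Gamma r N (of_nat m) = w powr (of_nat m - 1/2) * exp (- w) * scaled_Gamma r (of_nat m)"
    unfolding lanczos_Gamma_def m w_def by (simp only: lanczos_series_of_nat[OF assms(1) \<open>M \<le> N\<close>])
  also have "scaled_Gamma r (of_nat m) = Gamma (of_nat m) * exp w / w powr (of_nat m - 1/2)"
    by (simp add: scaled_Gamma_def w_def)
  also have "w powr (of_nat m - 1/2) * exp (- w) * \<dots> = Gamma (of_nat m)"
    using \<open>w \<noteq> 0\<close> by (simp add: exp_minus)
  finally show ?thesis .
qed

end
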